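(* For every $n\ge1$, $$\widetilde{B}_n(x,y)=\sum_{j=0}^{\lfloor n/2\rfloor}g(n,j)\,2^j(x+y)^j(1+x+y+xy)^{\lfloor n/2\rfloor-j},$$ $$\overline{B}_n(x,y)=\sum_{j=0}^{\lfloor n/2\rfloor}(-1)^j\bar g(n,j)\,2^j(x+y)^j(1+x+y+xy)^{\lfloor n/2\rfloor-j},$$ where $g(n,j)=|\{u\in\mathfrak{S}_n:\mathrm{lpk}(u)=j\}|$ and $\bar g(n,j)=\sum_{i=0}^{\lfloor n/2\rfloor-j}\binom{i+j}{j}g(n,i+j)2^i$.
   Context: $\mathcal{B}_n$ is the set of signed permutations of $\{\pm1,\dots,\pm n\}$ ($\sigma(-i)=-\sigma(i)$), each identified with the word $\sigma(0)\sigma(1)\cdots\sigma(n)$ with $\sigma(0)=0$. A position $i\in\{0,\dots,n-1\}$ is a descent if $\sigma(i)>\sigma(i+1)$ and an ascent if $\sigma(i)<\sigma(i+1)$; even positions include $0$. $\mathrm{des}_1,\mathrm{des}_0$ count descents at odd/even positions and $\mathrm{asc}_0$ ascents at even positions. $B_n(x,y)=\sum_{\sigma\in\mathcal{B}_n}x^{\mathrm{des}_1\sigma}y^{\mathrm{des}_0\sigma}$, $\widehat{B}_n(x,y)=\sum_{\sigma\in\mathcal{B}_n}x^{\mathrm{des}_1\sigma}y^{\mathrm{asc}_0\sigma}$; for $m\ge1$: $\widetilde{B}_{2m}=B_{2m}$, $\widetilde{B}_{2m-1}=(1+y)^{-1}B_{2m-1}$, $\overline{B}_{2m}=\widehat{B}_{2m}$,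 $\overline{B}_{2m-1}=(1+y)^{-1}\widehat{B}_{2m-1}$. For $u\in\mathfrak{S}_n$, $\mathrm{lpk}(u)=|\{1\le i<n: u(i-1)<u(i)>u(i+1)\}|$ with $u(0)=0$, $u(n+1)=n+1$. *)

theory Defs
  imports
    "HOL-Computational_Algebra.Computational_Algebra"
    "HOL-Combinatorics.Permutations"
begin

text \<open>
  The predicate \<^const>\<open>permutes\<close> makes a function the identity outside the given set, so the
  convention \<open>\<sigma>(0) = 0\<close> for signed permutations and the conventions \<open>u(0) = 0\<close>, \<open>u(n+1) = n+1\<close>
  for ordinary permutations hold automatically.
\<close>

definition signed_perms :: "nat \<Rightarrow> (int \<Rightarrow> int) set" where
  "signed_perms n = {\<sigma>. \<sigma> permutes ({- int n..int n} - {0}) \<and> (\<forall>i. \<sigma> (- i) = - \<sigma> i)}"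

definition perms :: "nat \<Rightarrow> (nat \<Rightarrow> nat) set" where
  "perms n = {u. u permutes {1..n}}"

definition des1 :: "nat \<Rightarrow> (int \<Rightarrow> int) \<Rightarrow> nat" where
  "des1 n \<sigma> = card {i. i < n \<and> odd i \<and> \<sigma> (int i) > \<sigma> (int (i + 1))}"

definition des0 :: "nat \<Rightarrow> (int \<Rightarrow> int) \<Rightarrow> nat" where
  "des0 n \<sigma> = card {i. i < n \<and> even i \<and> \<sigma> (int i) > \<sigma> (int (i + 1))}"

definition asc0 :: "nat \<Rightarrow> (int \<Rightarrow> int) \<Rightarrow> nat" where
  "asc0 n \<sigma> = card {i. i < n \<and> even i \<and> \<sigma> (int i) < \<sigma> (int (i + 1))}"

definition lpk :: "nat \<Rightarrow> (nat \<Rightarrow> nat) \<Rightarrow> nat" where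
  "lpk n u = card {i. 1 \<le> i \<and> i < n \<and> u (i - 1) < u i \<and> u i > u (i + 1)}"

text \<open>Polynomials in \<open>x\<close>, \<open>y\<close> over the integers are elements of \<open>\<int>[x][y]\<close>.\<close>

definition X :: "int poly poly" where
  "X = [:[:0, 1:]:]"

definition Y :: "int poly poly" where
  "Y = [:0, 1:]"

definition B :: "nat \<Rightarrow> int poly poly" where
  "B n = (\<Sum>\<sigma>\<in>signed_perms n. X ^ des1 n \<sigma> * Y ^ des0 n \<sigma>)"

definition B_hat :: "nat \<Rightarrow> int poly poly" where
  "B_hat n = (\<Sum>\<sigma>\<in>signed_perms n. X ^ des1 n \<sigma> * Y ^ asc0 n \<sigma>)"

text \<open>
  The factor \<open>(1 + y)\<^sup>-\<^sup>1\<close> is taken in the field of rational functions. The value at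
  \<open>n = 0\<close> is an artefact; these polynomials are only meant for \<open>n \<ge> 1\<close>.
\<close>

definition B_tilde :: "nat \<Rightarrow> int poly poly fract" where
  "B_tilde n = (if even n then to_fract (B n) else inverse (to_fract (1 + Y)) * to_fract (B n))"

definition B_bar :: "nat \<Rightarrow> int poly poly fract" where
  "B_bar n = (if even n then to_fract (B_hat n) else inverse (to_fract (1 + Y)) * to_fract (B_hat n))"

definition g :: "nat \<Rightarrow> nat \<Rightarrow> nat" where
  "g n j = card {u \<in> perms n. lpk n u = j}"

definition g_bar :: "nat \<Rightarrow> nat \<Rightarrow> nat" where
  "g_bar n j = (\<Sum>i = 0..n div 2 - j. ((i + j) choose j) * g n (i + j) * 2 ^ i)"

end

theory Submission
  imports Defs
begin

text \<open>
  Group the signed permutations \<open>\<sigma>\<close> by \<open>u = |\<sigma>|\<close>. Whether position \<open>i\<close> is a descent is decided by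
  the sign of the letter in which \<open>u\<close> takes the larger of the values \<open>u(i)\<close>, \<open>u(i+1)\<close>, so the sum
  over all choices of signs factorises over the letters. A peak of \<open>u\<close> decides two adjacent
  positions, one even and one odd, and contributes \<open>x + y\<close> (or \<open>1 + xy\<close> when ascents are counted
  at even positions); a valley decides none and contributes \<open>2\<close>; any other letter decides one
  position and contributes \<open>1 + x\<close> or \<open>1 + y\<close>. There are as many valleys as peaks. The second
  formula then follows from \<open>1 + xy = (1 + x)(1 + y) - (x + y)\<close> and the binomial theorem.
\<close>

section \<open>Signed permutations as permutations with a set of negated positions\<close>

definition attach_signs :: "(nat \<Rightarrow> nat) \<Rightarrow> nat set \<Rightarrow> int \<Rightarrow> int" where
  "attach_signs u S k = sgn k * (if nat \<bar>k\<bar> \<in> S then - 1 else 1) * int (u (nat \<bar>k\<bar>))"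

lemma attach_signs_of_nat:
  assumes "u \<in> perms n"
  shows "attach_signs u S (int i) = (if i \<in> S then - int (u i) else int (u i))"
proof (cases "i = 0")
  case True
  have "u 0 = 0"
    using assms by (simp add: perms_def permutes_def)
  then show ?thesis
    using True by (simp add: attach_signs_def)
qed (simp add: attach_signs_def)

text \<open>The factor \<open>sgn k\<close> makes the map odd. Its absolute value recovers that of
  \<open>k\<close> because \<open>u\<close> is injective, and oddness then recovers the sign;
  finiteness turns injectivity into bijectivity.\<close>

lemma attach_signs_in_signed_perms:
  assumes u: "u \<in> perms n" and S: "S \<subseteq> {1..n}"
  shows "attach_signs u S \<in> signed_perms n"
proof -
  let ?D = "{- int n..int n} - {0}" and ?f = "attach_signs u S"
  have up: "u permutes {1..n}"
    using u by (simp add: perms_def)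
  have abs_f: "\<bar>?f k\<bar> = int (u (nat \<bar>k\<bar>))" if "k \<noteq> 0" for k
    using that by (auto simp: attach_signs_def abs_mult abs_sgn_eq)
  have neg: "?f (- k) = - ?f k" for k
    by (simp add: attach_signs_def)
  have outside: "?f k = k" if "k \<notin> ?D" for k
  proof (cases "k = 0")
    case False
    then have "nat \<bar>k\<bar> \<notin> {1..n}"
      using that by auto
    then have "u (nat \<bar>k\<bar>) = nat \<bar>k\<bar>" "nat \<bar>k\<bar> \<notin> S"
      using up S by (auto simp: permutes_def)
    then show ?thesis
      by (simp add: attach_signs_def mult_sgn_abs)
  qed (simp add: attach_signs_def)
  have "inj_on ?f ?D"
  proof (rule inj_onI)
    fix k l assume k: "k \<in> ?D" and l: "l \<in> ?D" and eq: "?f k = ?f l"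
    have "u (nat \<bar>k\<bar>) = u (nat \<bar>l\<bar>)"
      using abs_f[of k] abs_f[of l] k l eq by simp
    then have "nat \<bar>k\<bar> = nat \<bar>l\<bar>"
      using permutes_inj[OF up] by (simp add: inj_eq)
    then have "k = l \<or> k = - l"
      by linarith
    \<comment> \<open>This excludes \<open>k = - l\<close>: oddness would then give
      \<open>?f l = - ?f l\<close>.\<close>
    moreover have "?f l \<noteq> 0"
    proof -
      have "nat \<bar>l\<bar> \<in> {1..n}"
        using l by auto
      then have "u (nat \<bar>l\<bar>) \<in> {1..n}"
        using permutes_in_image[OF up] by blast
      then show ?thesis
        using abs_f[of l] l by auto
    qed
    ultimately show "k = l"
      using eq neg[of l] by auto
  qed
  moreover have "?f ` ?D \<subseteq> ?D"
  proof
    fix m assume "m \<in> ?f ` ?D"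
    then obtain k where k: "k \<in> ?D" "m = ?f k"
      by blast
    have "nat \<bar>k\<bar> \<in> {1..n}"
      using k by auto
    then have "u (nat \<bar>k\<bar>) \<in> {1..n}"
      using permutes_in_image[OF up] by blast
    then show "m \<in> ?D"
      using abs_f[of k] k by auto
  qed
  ultimately have "bij_betw ?f ?D ?D"
    by (simp add: bij_betw_def endo_inj_surj)
  then have "?f permutes ?D"
    using outside by (intro bij_imp_permutes) auto
  then show ?thesis
    using neg by (simp add: signed_perms_def)
qed

lemma abs_signed_perm_in_perms:
  assumes "\<sigma> \<in> signed_perms n"
  shows "(\<lambda>i. nat \<bar>\<sigma> (int i)\<bar>) \<in> perms n"
proof -
  let ?D = "{- int n..int n} - {0}" and ?u = "\<lambda>i. nat \<bar>\<sigma> (int i)\<bar>"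
  have p: "\<sigma> permutes ?D" and neg: "\<And>i. \<sigma> (- i) = - \<sigma> i"
    using assms by (auto simp: signed_perms_def)
  have "inj_on ?u {1..n}"
  proof (rule inj_onI)
    fix i j assume ij: "i \<in> {1..n}" "j \<in> {1..n}" "?u i = ?u j"
    have "\<sigma> (int i) = \<sigma> (int j) \<or> \<sigma> (int i) = \<sigma> (- int j)"
      using ij(3) neg[of "int j"] by linarith
    then show "i = j"
      using permutes_inj[OF p] by (auto simp: inj_eq)
  qed
  moreover have "?u ` {1..n} \<subseteq> {1..n}"
  proof
    fix m assume "m \<in> ?u ` {1..n}"
    then obtain i where i: "i \<in> {1..n}" "m = ?u i"
      by auto
    have "\<sigma> (int i) \<in> ?D"
      using permutes_in_image[OF p, of "int i"] i by auto
    then show "m \<in> {1..n}"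
      using i by auto
  qed
  ultimately have "bij_betw ?u {1..n} {1..n}"
    by (simp add: bij_betw_def endo_inj_surj)
  moreover have "?u i = i" if "i \<notin> {1..n}" for i
  proof -
    have "int i \<notin> ?D"
      using that by auto
    then show ?thesis
      using p by (simp add: permutes_def)
  qed
  ultimately show ?thesis
    unfolding perms_def by (auto intro: bij_imp_permutes)
qed

text \<open>A signed permutation corresponds to its absolute values together with the set of
  positive positions where it is negative; \<open>attach_signs\<close> inverts this.\<close>

lemma sum_signed_perms:
  "(\<Sum>\<sigma>\<in>signed_perms n. f \<sigma>) = (\<Sum>u\<in>perms n. \<Sum>S\<in>Pow {1..n}. f (attach_signs u S))"
proof -
  have "(\<Sum>\<sigma>\<in>signed_perms n. f \<sigma>) = (\<Sum>(u, S)\<in>perms n \<times> Pow {1..n}. f (attach_signs u S))"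
  proof (rule sum.reindex_bij_witness
      [where i = "\<lambda>(u, S). attach_signs u S"
         and j = "\<lambda>\<sigma>. (\<lambda>i. nat \<bar>\<sigma> (int i)\<bar>, {i \<in> {1..n}. \<sigma> (int i) < 0})"])
    fix \<sigma> assume \<sigma>: "\<sigma> \<in> signed_perms n"
    have p: "\<sigma> permutes ({- int n..int n} - {0})" and neg: "\<And>i. \<sigma> (- i) = - \<sigma> i"
      using \<sigma> by (auto simp: signed_perms_def)
    let ?u = "\<lambda>i. nat \<bar>\<sigma> (int i)\<bar>" and ?S = "{i \<in> {1..n}. \<sigma> (int i) < 0}"
    have u: "?u \<in> perms n"
      by (rule abs_signed_perm_in_perms[OF \<sigma>])
    have nat: "attach_signs ?u ?S (int i) = \<sigma> (int i)" for i
    proof (cases "i \<in> {1..n}")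
      case False
      then have "\<sigma> (int i) = int i"
        using p by (auto simp: permutes_def)
      then show ?thesis
        using False by (subst attach_signs_of_nat[OF u]) auto
    qed (subst attach_signs_of_nat[OF u], auto)
    have "attach_signs ?u ?S k = \<sigma> k" for k
    proof (cases "k \<ge> 0")
      case True
      then show ?thesis
        using nat[of "nat k"] by simp
    next
      case False
      have "attach_signs ?u ?S k = - attach_signs ?u ?S (- k)"
        by (simp add: attach_signs_def)
      also have "\<dots> = - \<sigma> (- k)"
        using False nat[of "nat (- k)"] by simp
      finally show ?thesis
        using neg by simp
    qed
    then show eq: "(case (?u, ?S) of (u, S) \<Rightarrow> attach_signs u S) = \<sigma>"
      by auto
    show "(?u, ?S) \<in> perms n \<times> Pow {1..n}"
      using u by auto
    show "(case (?u, ?S) of (u, S) \<Rightarrow> f (attach_signs u S)) = f \<sigma>"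
      using eq by simp
  next
    fix uS assume "uS \<in> perms n \<times> Pow {1..n}"
    then obtain u S where uS: "uS = (u, S)" "u \<in> perms n" "S \<subseteq> {1..n}"
      by auto
    show "(case uS of (u, S) \<Rightarrow> attach_signs u S) \<in> signed_perms n"
      using uS attach_signs_in_signed_perms by simp
    \<comment> \<open>A zero letter would be negative for no choice of \<open>S\<close>; its absence
      lets \<open>S\<close> be read off from the signs.\<close>
    have "u i \<noteq> 0" if "i \<in> {1..n}" for i
      using that uS(2) permutes_in_image[of u "{1..n}" i] by (auto simp: perms_def)
    then have "{i \<in> {1..n}. attach_signs u S (int i) < 0} = S"
      using uS(3) by (auto simp: attach_signs_of_nat[OF uS(2)])
    then show "(\<lambda>i. nat \<bar>(case uS of (u, S) \<Rightarrow> attach_signs u S) (int i)\<bar>,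
        {i \<in> {1..n}. (case uS of (u, S) \<Rightarrow> attach_signs u S) (int i) < 0}) = uS"
      using uS(1) by (auto simp: attach_signs_of_nat[OF uS(2)])
  qed
  also have "\<dots> = (\<Sum>u\<in>perms n. \<Sum>S\<in>Pow {1..n}. f (attach_signs u S))"
    by (simp add: sum.cartesian_product)
  finally show ?thesis .
qed

section \<open>Factorisation of the weight over the letters\<close>

definition descent_weight ::
  "nat \<Rightarrow> (nat \<Rightarrow> 'a) \<Rightarrow> (nat \<Rightarrow> 'a) \<Rightarrow> (int \<Rightarrow> int) \<Rightarrow> 'a :: comm_semiring_1" where
  "descent_weight n a d \<sigma> = (\<Prod>i<n. if \<sigma> (int i) > \<sigma> (int (i + 1)) then d i else a i)"

text \<open>The sign of the \<open>i\<close>-th letter decides position \<open>i - 1\<close> if \<open>u(i-1) < u(i)\<close>, and position \<open>i\<close> if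
  \<open>u(i) > u(i+1)\<close>.\<close>

definition letter_weight ::
  "(nat \<Rightarrow> 'a) \<Rightarrow> (nat \<Rightarrow> 'a) \<Rightarrow> (nat \<Rightarrow> nat) \<Rightarrow> bool \<Rightarrow> nat \<Rightarrow> 'a :: comm_semiring_1" where
  "letter_weight a d u neg i =
     (if u (i - 1) < u i then (if neg then d (i - 1) else a (i - 1)) else 1) *
     (if u (i + 1) < u i then (if neg then a i else d i) else 1)"

text \<open>Adjacent letters differ in absolute value, so the sign of the larger one alone decides
  the position between them. Regrouping the position factors by that larger letter gives the
  product.\<close>

lemma descent_weight_attach_signs:
  assumes u: "u \<in> perms n" and S: "S \<subseteq> {1..n}"
  shows "descent_weight n a d (attach_signs u S) = (\<Prod>i=1..n. letter_weight a d u (i \<in> S) i)"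
proof -
  have up: "u permutes {1..n}"
    using u by (simp add: perms_def)
  have u0: "u 0 = 0"
    using up by (simp add: permutes_def)
  have last: "\<not> u (n + 1) < u n"
  proof (cases "n = 0")
    case False
    then have "u n \<in> {1..n}"
      using permutes_in_image[OF up] by auto
    moreover have "u (n + 1) = n + 1"
      using up by (simp add: permutes_def)
    ultimately show ?thesis
      by auto
  qed (use u0 in simp)
  \<comment> \<open>\<open>L i\<close> is the factor of position \<open>i\<close> if the larger
    letter stands at \<open>i + 1\<close>, \<open>R i\<close> if it stands at \<open>i\<close>; the
    other one is 1.\<close>
  define L where "L i = (if u i < u (i + 1) then (if i + 1 \<in> S then d i else a i) else 1)" for i
  define R where "R i = (if u (i + 1) < u i then (if i \<in> S then a i else d i) else 1)" for i
  have "(if attach_signs u S (int i) > attach_signs u S (int (i + 1)) then d i else a i)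
    = L i * R i" for i
  proof -
    have "u i \<noteq> u (i + 1)"
      using permutes_inj[OF up] by (simp add: inj_eq)
    then show ?thesis
      unfolding attach_signs_of_nat[OF u] L_def R_def by auto
  qed
  then have "descent_weight n a d (attach_signs u S) = (\<Prod>i<n. L i) * (\<Prod>i<n. R i)"
    by (simp add: descent_weight_def prod.distrib)
  also have "(\<Prod>i<n. L i) = (\<Prod>i=1..n. L (i - 1))"
    by (rule prod.reindex_bij_witness[where i = "\<lambda>i. i - 1" and j = Suc]) auto
  \<comment> \<open>Positions run from 0 to \<open>n - 1\<close> but letters from 1 to
    \<open>n\<close>: \<open>R n = 1\<close> by \<open>last\<close>, and \<open>R 0 = 1\<close>
    since \<open>u 0 = 0\<close>.\<close>
  also have "(\<Prod>i<n. R i) = (\<Prod>i\<le>n. R i)"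
    using last by (simp add: lessThan_Suc_atMost[symmetric] R_def)
  also have "\<dots> = (\<Prod>i=1..n. R i)"
    using u0 by (intro prod.mono_neutral_right) (auto simp: R_def not_less_eq_eq)
  also have "(\<Prod>i=1..n. L (i - 1)) * (\<Prod>i=1..n. R i) = (\<Prod>i=1..n. letter_weight a d u (i \<in> S) i)"
    unfolding prod.distrib[symmetric]
    by (rule prod.cong) (auto simp: L_def R_def letter_weight_def)
  finally show ?thesis .
qed

section \<open>Summation over the signs\<close>

lemma sum_Pow_prod:
  fixes f h :: "'b \<Rightarrow> 'a :: comm_semiring_1"
  assumes "finite A"
  shows "(\<Sum>S\<in>Pow A. \<Prod>i\<in>A. if i \<in> S then f i else h i) = (\<Prod>i\<in>A. f i + h i)"
proof -
  have "(\<Prod>i\<in>A. if i \<in> S then f i else h i) = prod f S * prod h (A - S)" if "S \<in> Pow A" for S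
    using assms that by (simp add: prod.If_cases Int_absorb1 Diff_eq)
  then show ?thesis
    using prod_add[OF assms, of f h] by simp
qed

text \<open>The positions below \<open>n\<close> pair up as one even and one odd; for odd
  \<open>n\<close> the last even one is left over and gives the extra \<open>q\<close>.\<close>

lemma prod_alternating:
  fixes p q :: "'a :: comm_semiring_1"
  shows "(\<Prod>i<n. if even i then q else p) = (if even n then 1 else q) * (p * q) ^ (n div 2)"
  by (induction n) (auto simp: ac_simps elim!: oddE evenE)

text \<open>Two peaks are never adjacent, so the peaks and their left neighbours form disjoint sets
  of equal size among the positions below \<open>n\<close>.\<close>

lemma lpk_le_half: "lpk n u \<le> n div 2"
proof -
  define P where "P = {i. 1 \<le> i \<and> i < n \<and> u (i - 1) < u i \<and> u i > u (i + 1)}"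
  have fin: "finite P"
    by (simp add: P_def)
  have inj: "inj_on (\<lambda>i. i - 1) P"
    by (auto simp: P_def inj_on_def)
  have "card P + card P = card (P \<union> (\<lambda>i. i - 1) ` P)"
    using fin card_image[OF inj] by (subst card_Un_disjoint) (auto simp: P_def)
  also have "\<dots> \<le> card {..<n}"
    by (rule card_mono) (auto simp: P_def)
  finally show ?thesis
    by (simp add: lpk_def P_def)
qed

text \<open>Letters fall into four classes by the comparisons with their two neighbours. Relative to
  the product of \<open>a i + d i\<close> over all positions, each peak replaces the sums
  \<open>p\<close> and \<open>q\<close> of its two positions by \<open>c\<close>, and each valley
  adds a factor 2.\<close>

lemma prod_letter_weights:
  fixes a d :: "nat \<Rightarrow> 'a :: idom"
  assumes u: "u \<in> perms n"
    and ad: "\<And>i. a i + d i = (if even i then q else p)"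
    and c: "\<And>i. a i * d (Suc i) + d i * a (Suc i) = c"
    and nz: "p * q \<noteq> 0"
  shows "(\<Prod>i=1..n. letter_weight a d u True i + letter_weight a d u False i) =
    (if even n then 1 else q) * (2 ^ lpk n u * c ^ lpk n u * (p * q) ^ (n div 2 - lpk n u))"
proof -
  have up: "u permutes {1..n}"
    using u by (simp add: perms_def)
  have u0: "u 0 = 0"
    using up by (simp add: permutes_def)
  have last: "u n \<le> u (Suc n)"
  proof (cases "n = 0")
    case False
    then have "u n \<in> {1..n}"
      using permutes_in_image[OF up] by auto
    moreover have "u (Suc n) = Suc n"
      using up by (simp add: permutes_def)
    ultimately show ?thesis
      by auto
  qed (use u0 in simp)
  have neq: "u i \<noteq> u (Suc i)" for i
    using permutes_inj[OF up] by (simp add: inj_eq)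
  \<comment> \<open>\<open>A\<close> holds the letters that decide the position to their left,
    \<open>D\<close> those that decide the position to their right; peaks lie in both, valleys in
    neither.\<close>
  define A where "A = {i \<in> {1..n}. u (i - 1) < u i}"
  define D where "D = {i \<in> {1..n}. u (i + 1) < u i}"
  define s where "s i = (if even i then q else p)" for i :: nat
  define w where "w i = letter_weight a d u True i + letter_weight a d u False i" for i
  have fin: "finite A" "finite D"
    by (auto simp: A_def D_def)
  have lpk: "lpk n u = card (A \<inter> D)"
  proof -
    \<comment> \<open>By \<open>last\<close>, \<open>n\<close> is not in \<open>D\<close>, which
      matches the bound \<open>i < n\<close> in \<open>lpk\<close>.\<close>
    have "{i. 1 \<le> i \<and> i < n \<and> u (i - 1) < u i \<and> u i > u (i + 1)} = A \<inter> D"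
      using last by (auto simp: A_def D_def) (metis leD le_neq_implies_less)
    then show ?thesis
      by (simp add: lpk_def)
  qed
  have inj: "inj_on (\<lambda>i. i - 1) A"
    by (auto simp: A_def inj_on_def)
  have disj: "(\<lambda>i. i - 1) ` A \<inter> D = {}"
    by (auto simp: A_def D_def)
  \<comment> \<open>Every position is decided by exactly one letter, so \<open>A\<close> shifted by
    one and \<open>D\<close> partition the positions.\<close>
  have cover: "(\<lambda>i. i - 1) ` A \<union> D = {..<n}"
  proof
    show "(\<lambda>i. i - 1) ` A \<union> D \<subseteq> {..<n}"
      using last by (auto simp: A_def D_def) (metis leD le_neq_implies_less)
    show "{..<n} \<subseteq> (\<lambda>i. i - 1) ` A \<union> D"
    proof
      fix i assume i: "i \<in> {..<n}"
      show "i \<in> (\<lambda>i. i - 1) ` A \<union> D"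
      proof (cases "u i < u (Suc i)")
        case True
        then have "Suc i \<in> A"
          using i by (simp add: A_def)
        then show ?thesis
          by (metis UnI1 diff_Suc_1 imageI)
      next
        case False
        then have "u (Suc i) < u i"
          using neq[of i] by simp
        moreover have "i \<noteq> 0"
          using calculation u0 by (cases i) auto
        ultimately show ?thesis
          using i by (simp add: D_def)
      qed
    qed
  qed
  have card_AD: "card A + card D = n"
    using card_Un_disjoint[of "(\<lambda>i. i - 1) ` A" D] fin disj cover card_image[OF inj] by simp
  \<comment> \<open>Since \<open>card A + card D = n\<close>, inclusion-exclusion leaves as many
    letters outside the union as there are in the intersection.\<close>
  have card_valleys: "card ({1..n} - (A \<union> D)) = card (A \<inter> D)"
  proof -
    have "A \<union> D \<subseteq> {1..n}"
      by (auto simp: A_def D_def)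
    then have "card ({1..n} - (A \<union> D)) = n - card (A \<union> D)"
      using fin by (simp add: card_Diff_subset)
    then show ?thesis
      using card_Un_Int[OF fin] card_AD by simp
  qed
  have prod_s: "(\<Prod>i\<in>A. s (i - 1)) * (\<Prod>i\<in>D. s i) = (if even n then 1 else q) * (p * q) ^ (n div 2)"
  proof -
    have "(\<Prod>i\<in>A. s (i - 1)) * (\<Prod>i\<in>D. s i) = prod s ((\<lambda>i. i - 1) ` A \<union> D)"
      using fin disj
      by (subst prod.union_disjoint) (simp_all only: prod.reindex[OF inj] comp_def finite_imageI)
    also have "\<dots> = (if even n then 1 else q) * (p * q) ^ (n div 2)"
      unfolding cover s_def by (rule prod_alternating)
    finally show ?thesis .
  qed
  \<comment> \<open>At a peak a minus sign gives \<open>d (i - 1) * a i\<close>, a plus sign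
    \<open>a (i - 1) * d i\<close>.\<close>
  have w_peak: "w i = c" if "i \<in> A \<inter> D" for i
    using that c[of "i - 1"] by (auto simp: w_def letter_weight_def A_def D_def ac_simps)
  have w_asc: "w i = s (i - 1)" if "i \<in> A - D" for i
    using that ad[of "i - 1"]
    by (auto simp: w_def letter_weight_def A_def D_def s_def ac_simps)
  have w_des: "w i = s i" if "i \<in> D - A" for i
    using that ad[of i] by (auto simp: w_def letter_weight_def A_def D_def s_def ac_simps)
  have w_valley: "w i = 2" if "i \<in> {1..n} - (A \<union> D)" for i
    using that by (auto simp: w_def letter_weight_def A_def D_def)
  \<comment> \<open>The two positions next to a letter have opposite parity.\<close>
  have s_adjacent: "s (i - 1) * s i = p * q" if "i \<in> A \<inter> D" for i
    using that by (cases i) (auto simp: A_def s_def)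
  let ?k = "card (A \<inter> D)"
  have "{1..n} = (A \<inter> D) \<union> (A - D) \<union> (D - A) \<union> ({1..n} - (A \<union> D))"
    by (auto simp: A_def D_def)
  then have "prod w {1..n} = prod w ((A \<inter> D) \<union> (A - D) \<union> (D - A) \<union> ({1..n} - (A \<union> D)))"
    by simp
  also have "\<dots> = prod w (A \<inter> D) * prod w (A - D) * prod w (D - A) * prod w ({1..n} - (A \<union> D))"
    using fin
    by (subst prod.union_disjoint; (subst prod.union_disjoint)?; (subst prod.union_disjoint)?; auto)
  also have "\<dots> = c ^ ?k * (\<Prod>i\<in>A - D. s (i - 1)) * (\<Prod>i\<in>D - A. s i) * 2 ^ ?k"
    using card_valleys by (simp add: w_peak w_asc w_des w_valley)
  finally have prod_w: "prod w {1..n} =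
      c ^ ?k * (\<Prod>i\<in>A - D. s (i - 1)) * (\<Prod>i\<in>D - A. s i) * 2 ^ ?k" .
  have "(\<Prod>i\<in>A \<inter> D. s (i - 1) * s i) = (\<Prod>i\<in>A \<inter> D. p * q)"
    by (intro prod.cong refl s_adjacent)
  then have pq: "(\<Prod>i\<in>A \<inter> D. s (i - 1)) * (\<Prod>i\<in>A \<inter> D. s i) = (p * q) ^ ?k"
    by (simp only: prod.distrib[symmetric] prod_constant)
  \<comment> \<open>The factor \<open>(p * q) ^ ?k\<close> supplies the position sums missing at the
    peaks and so completes the product to that of \<open>prod_s\<close>; it is cancelled at the end
    because \<open>p * q\<close> is nonzero.\<close>
  have "(\<Prod>i\<in>A - D. s (i - 1)) * (\<Prod>i\<in>D - A. s i) * (p * q) ^ ?k =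
      (\<Prod>i\<in>A. s (i - 1)) * (\<Prod>i\<in>D. s i)"
    unfolding pq[symmetric]
    using prod.Int_Diff[OF fin(1), of "\<lambda>i. s (i - 1)" D] prod.Int_Diff[OF fin(2), of s A]
    by (simp only: ac_simps Int_commute)
  also note prod_s
  also have "(p * q) ^ (n div 2) = (p * q) ^ (n div 2 - ?k) * (p * q) ^ ?k"
    using lpk_le_half[of n u] lpk by (simp add: power_add[symmetric])
  finally have rest: "(\<Prod>i\<in>A - D. s (i - 1)) * (\<Prod>i\<in>D - A. s i) * (p * q) ^ ?k =
      (if even n then 1 else q) * ((p * q) ^ (n div 2 - ?k) * (p * q) ^ ?k)" .
  have "prod w {1..n} * (p * q) ^ ?k =
      2 ^ ?k * c ^ ?k * ((\<Prod>i\<in>A - D. s (i - 1)) * (\<Prod>i\<in>D - A. s i) * (p * q) ^ ?k)"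
    unfolding prod_w by (simp only: ac_simps)
  also note rest
  finally have "prod w {1..n} * (p * q) ^ ?k =
      (if even n then 1 else q) * (2 ^ ?k * c ^ ?k * (p * q) ^ (n div 2 - ?k)) * (p * q) ^ ?k"
    by (simp only: ac_simps)
  then show "(\<Prod>i=1..n. letter_weight a d u True i + letter_weight a d u False i) =
      (if even n then 1 else q) * (2 ^ lpk n u * c ^ lpk n u * (p * q) ^ (n div 2 - lpk n u))"
    using nz unfolding lpk w_def by simp
qed

text \<open>The weights stay free so that one evaluation serves both \<open>B\<close> and
  \<open>B_hat\<close>; in each case a peak contributes the same \<open>c\<close> whatever its
  parity. Grouping permutations by \<open>lpk\<close> produces \<open>g\<close>.\<close>

lemma sum_descent_weight:
  fixes a d :: "nat \<Rightarrow> 'a :: idom"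
  assumes s: "\<And>i. a i + d i = (if even i then q else p)"
    and c: "\<And>i. a i * d (Suc i) + d i * a (Suc i) = c"
    and nz: "p * q \<noteq> 0"
  shows "(\<Sum>\<sigma>\<in>signed_perms n. descent_weight n a d \<sigma>) = (if even n then 1 else q) *
    (\<Sum>j = 0..n div 2. of_nat (g n j) * 2 ^ j * c ^ j * (p * q) ^ (n div 2 - j))"
proof -
  define t where "t j = 2 ^ j * c ^ j * (p * q) ^ (n div 2 - j)" for j
  have fin: "finite (perms n)"
    by (simp add: perms_def finite_permutations)
  have "(\<Sum>S\<in>Pow {1..n}. descent_weight n a d (attach_signs u S)) =
      (if even n then 1 else q) * t (lpk n u)"
    if u: "u \<in> perms n" for u
  proof -
    have "(\<Sum>S\<in>Pow {1..n}. descent_weight n a d (attach_signs u S)) =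
        (\<Sum>S\<in>Pow {1..n}. \<Prod>i=1..n.
          if i \<in> S then letter_weight a d u True i else letter_weight a d u False i)"
      by (intro sum.cong refl, subst descent_weight_attach_signs[OF u]) (auto intro!: prod.cong)
    also have "\<dots> = (\<Prod>i=1..n. letter_weight a d u True i + letter_weight a d u False i)"
      by (rule sum_Pow_prod) simp
    finally show ?thesis
      using prod_letter_weights[OF u s c nz] by (simp add: t_def)
  qed
  then have "(\<Sum>\<sigma>\<in>signed_perms n. descent_weight n a d \<sigma>) =
      (if even n then 1 else q) * (\<Sum>u\<in>perms n. t (lpk n u))"
    by (simp add: sum_signed_perms sum_distrib_left)
  also have "(\<Sum>u\<in>perms n. t (lpk n u)) =
      (\<Sum>j = 0..n div 2. \<Sum>u\<in>{u \<in> perms n. lpk n u = j}. t (lpk n u))"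
    using fin lpk_le_half by (intro sum.group[symmetric]) auto
  also have "\<dots> = (\<Sum>j = 0..n div 2. of_nat (g n j) * t j)"
    by (simp add: g_def)
  finally show ?thesis
    by (simp add: t_def mult.assoc)
qed

section \<open>Specialisation to \<open>B\<close> and \<open>B_hat\<close>\<close>

lemma power_card_filter:
  fixes z :: "'a :: comm_monoid_mult" and n :: nat
  shows "z ^ card {i. i < n \<and> P i} = (\<Prod>i<n. if P i then z else 1)"
proof -
  have "z ^ card {i. i < n \<and> P i} = (\<Prod>i\<in>{i \<in> {..<n}. P i}. z)"
    by simp
  also have "\<dots> = (\<Prod>i<n. if P i then z else 1)"
    by (rule prod.inter_filter) simp
  finally show ?thesis .
qed

lemma B_eq_sum_descent_weight:
  "B n = (\<Sum>\<sigma>\<in>signed_perms n. descent_weight n (\<lambda>_. 1) (\<lambda>i. if even i then Y else X) \<sigma>)"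
  unfolding B_def des1_def des0_def power_card_filter descent_weight_def prod.distrib[symmetric]
  by (intro sum.cong prod.cong refl) auto

lemma B_hat_eq_sum_descent_weight:
  "B_hat n = (\<Sum>\<sigma>\<in>signed_perms n.
     descent_weight n (\<lambda>i. if even i then Y else 1) (\<lambda>i. if even i then 1 else X) \<sigma>)"
  unfolding B_hat_def des1_def asc0_def power_card_filter descent_weight_def prod.distrib[symmetric]
proof (intro sum.cong prod.cong refl)
  fix \<sigma> i assume "\<sigma> \<in> signed_perms n"
  \<comment> \<open>Injectivity makes adjacent values distinct, so a position is an ascent exactly
    when it is not a descent.\<close>
  then have "\<sigma> (int i) \<noteq> \<sigma> (int (i + 1))"
    using permutes_inj by (fastforce simp: signed_perms_def inj_eq)
  then show "(if odd i \<and> \<sigma> (int (i + 1)) < \<sigma> (int i) then X else 1) *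
      (if even i \<and> \<sigma> (int i) < \<sigma> (int (i + 1)) then Y else 1) =
    (if \<sigma> (int (i + 1)) < \<sigma> (int i) then if even i then 1 else X else if even i then Y else 1)"
    by auto
qed

text \<open>Expand \<open>(s - r) ^ k\<close> by the binomial theorem, exchange the sums and put
  \<open>k = i + j\<close>; then \<open>2 ^ k\<close> splits into the \<open>2 ^ i\<close> inside
  \<open>g_bar\<close> and the \<open>2 ^ j\<close> outside.\<close>

lemma sum_g_diff_power:
  fixes r s :: "'a :: comm_ring_1"
  shows "(\<Sum>k = 0..n div 2. of_nat (g n k) * 2 ^ k * (s - r) ^ k * s ^ (n div 2 - k)) =
    (\<Sum>j = 0..n div 2. (- 1) ^ j * of_nat (g_bar n j) * 2 ^ j * r ^ j * s ^ (n div 2 - j))"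
proof -
  let ?m = "n div 2"
  define h where "h j k =
    of_nat (g n k) * 2 ^ k * of_nat (k choose j) * (- 1) ^ j * r ^ j * s ^ (?m - j)" for j k
  have "(\<Sum>k = 0..?m. of_nat (g n k) * 2 ^ k * (s - r) ^ k * s ^ (?m - k)) =
      (\<Sum>k = 0..?m. \<Sum>j = 0..k. h j k)"
  proof (intro sum.cong refl)
    fix k assume k: "k \<in> {0..?m}"
    have "(s - r) ^ k = (\<Sum>j\<le>k. of_nat (k choose j) * (- r) ^ j * s ^ (k - j))"
      using binomial_ring[of "- r" s k] by simp
    then have "of_nat (g n k) * 2 ^ k * (s - r) ^ k * s ^ (?m - k) =
        (\<Sum>j = 0..k. of_nat (g n k) * 2 ^ k *
          (of_nat (k choose j) * (- r) ^ j * s ^ (k - j)) * s ^ (?m - k))"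
      by (simp add: sum_distrib_left sum_distrib_right atLeast0AtMost)
    also have "\<dots> = (\<Sum>j = 0..k. h j k)"
    proof (intro sum.cong refl)
      fix j assume "j \<in> {0..k}"
      \<comment> \<open>The truncated differences add up because j \<le> k \<le>
        \<open>?m\<close>.\<close>
      then have "s ^ (?m - j) = s ^ (k - j) * s ^ (?m - k)"
        using k by (simp add: power_add[symmetric])
      then show "of_nat (g n k) * 2 ^ k *
          (of_nat (k choose j) * (- r) ^ j * s ^ (k - j)) * s ^ (?m - k) = h j k"
        by (simp add: h_def power_minus[of r] ac_simps)
    qed
    finally show "of_nat (g n k) * 2 ^ k * (s - r) ^ k * s ^ (?m - k) = (\<Sum>j = 0..k. h j k)" .
  qed
  also have "\<dots> = (\<Sum>j = 0..?m. \<Sum>k = j..?m. h j k)"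
    unfolding sum.Sigma[OF finite_atLeastAtMost ballI[OF finite_atLeastAtMost]]
    by (rule sum.reindex_bij_witness[where i = "\<lambda>(j, k). (k, j)" and j = "\<lambda>(k, j). (j, k)"]) auto
  also have "\<dots> = (\<Sum>j = 0..?m. (- 1) ^ j * of_nat (g_bar n j) * 2 ^ j * r ^ j * s ^ (?m - j))"
  proof (intro sum.cong refl)
    fix j assume "j \<in> {0..?m}"
    then have "(\<Sum>k = j..?m. h j k) = (\<Sum>i = 0..?m - j. h j (i + j))"
      using sum.shift_bounds_cl_nat_ivl[of "h j" 0 j "?m - j"] by simp
    also have "\<dots> = (- 1) ^ j * of_nat (g_bar n j) * 2 ^ j * r ^ j * s ^ (?m - j)"
      by (simp add: h_def g_bar_def sum_distrib_left sum_distrib_right power_add ac_simps)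
    finally show "(\<Sum>k = j..?m. h j k) =
        (- 1) ^ j * of_nat (g_bar n j) * 2 ^ j * r ^ j * s ^ (?m - j)" .
  qed
  finally show ?thesis .
qed

theorem theorem2p13:
  fixes n :: nat
  assumes "n \<ge> 1"
  shows "B_tilde n = to_fract (\<Sum>j = 0..n div 2.
            of_nat (g n j) * 2 ^ j * (X + Y) ^ j * (1 + X + Y + X * Y) ^ (n div 2 - j))
       \<and> B_bar n = to_fract (\<Sum>j = 0..n div 2.
            (- 1) ^ j * of_nat (g_bar n j) * 2 ^ j * (X + Y) ^ j
              * (1 + X + Y + X * Y) ^ (n div 2 - j))"
proof -
  have nz: "1 + X \<noteq> 0" "1 + Y \<noteq> 0"
    by (simp_all add: X_def Y_def one_pCons)
  have pq: "(1 + X) * (1 + Y) = 1 + X + Y + X * Y"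
    by (simp add: algebra_simps)
  have "B n = (if even n then 1 else 1 + Y) * (\<Sum>j = 0..n div 2.
      of_nat (g n j) * 2 ^ j * (X + Y) ^ j * ((1 + X) * (1 + Y)) ^ (n div 2 - j))"
    unfolding B_eq_sum_descent_weight using nz by (intro sum_descent_weight) (auto simp: ac_simps)
  \<comment> \<open>A peak now contributes \<open>1 + X * Y\<close>, written as a difference so that
    \<open>sum_g_diff_power\<close> applies with \<open>r = X + Y\<close>.\<close>
  moreover have "B_hat n = (if even n then 1 else 1 + Y) * (\<Sum>j = 0..n div 2.
      of_nat (g n j) * 2 ^ j * ((1 + X + Y + X * Y) - (X + Y)) ^ j
        * ((1 + X) * (1 + Y)) ^ (n div 2 - j))"
    unfolding B_hat_eq_sum_descent_weight using nz
    by (intro sum_descent_weight) (auto simp: ac_simps)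
  \<comment> \<open>For odd \<open>n\<close> this cancels the factor \<open>1 + Y\<close> left by
    the unpaired even position.\<close>
  moreover have "inverse (to_fract (1 + Y)) * to_fract ((1 + Y) * z) = to_fract z" for z
  proof -
    have "inverse (to_fract (1 + Y)) * to_fract (1 + Y) = 1"
      using nz(2) by (intro left_inverse) (simp only: to_fract_eq_0_iff not_False_eq_True)
    then show ?thesis
      by (simp only: to_fract_mult mult.assoc[symmetric] mult_1_left)
  qed
  ultimately show ?thesis
    unfolding B_tilde_def B_bar_def pq sum_g_diff_power
    by (simp del: to_fract_mult to_fract_add to_fract_sum)
qed

end
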